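(* Let $X$ be a real Hilbert space, let $R\colon X\to X$ be linear and nonexpansive (i.e., $\|Rx-Ry\|\le\|x-y\|$ for all $x,y\in X$), and set $D:=\ker(\mathrm{Id}-R)=\operatorname{Fix}R$. Then the following hold: (i) $D$ is a closed linear subspace of $X$. (ii) $\operatorname{Fix}R^*=D$. (iii) $\overline{\operatorname{ran}}(\mathrm{Id}-R)=\overline{\operatorname{ran}}(\mathrm{Id}-R^* )=D^\perp$.
   Context: $\operatorname{Fix}R=\{x\in X: Rx=x\}$, $R^*$ is the Hilbert space adjoint of $R$, $\mathrm{Id}$ is the identity on $X$, $\overline{\operatorname{ran}}$ denotes the norm closure of the range, and $D^\perp$ is the orthogonal complement of $D$. *)

theory Defs
  imports "HOL-Analysis.Analysis"
begin

definition Fix :: "('a \<Rightarrow> 'a) \<Rightarrow> 'a set"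
  where "Fix T = {x. T x = x}"

text \<open>
  A real Hilbert space is a type of sort \<open>{real_inner, complete_space}\<close>. The library constant
  \<^const>\<open>adjoint\<close> is an arbitrary map with \<open>f x \<bullet> y = x \<bullet> adjoint f y\<close>, if there is any. For
  a bounded linear map on a Hilbert space exactly one such map exists (by Riesz representation),
  so there \<^const>\<open>adjoint\<close> is the Hilbert space adjoint, also in infinite dimension.
\<close>

end

theory Submission
  imports Defs
begin

text \<open>
  The inner product identity for \<open>R\<close> and its adjoint makes the orthogonal complement of
  \<open>ran (Id - R)\<close> equal to \<open>ker (Id - R\<^sup>*)\<close>, and conversely; since the double orthogonal
  complement of a subspace is its closure, (iii) follows from (ii). For (ii), a contraction \<open>T\<close>
  with \<open>x \<bullet> T x = x \<bullet> x\<close> fixes \<open>x\<close>, because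
  \<open>\<parallel>T x - x\<parallel>\<^sup>2 \<le> 2 \<parallel>x\<parallel>\<^sup>2 - 2 (x \<bullet> T x) = 0\<close>, and the condition \<open>x \<bullet> T x = x \<bullet> x\<close> is the same
  for \<open>R\<close> and \<open>R\<^sup>*\<close>. The adjoint exists by the Riesz representation theorem.
\<close>

section \<open>Orthogonal projection and Riesz representation\<close>

lemma subspace_closure:
  fixes S :: "'a::real_normed_vector set"
  assumes "subspace S"
  shows "subspace (closure S)"
proof (rule subspaceI)
  show "0 \<in> closure S"
    using assms closure_subset subspace_0 by blast
next
  fix x y assume "x \<in> closure S" "y \<in> closure S"
  then obtain a b where "\<And>n. a n \<in> S" "a \<longlonglongrightarrow> x" "\<And>n. b n \<in> S" "b \<longlonglongrightarrow> y"
    unfolding closure_sequential by blast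
  then have "\<And>n. a n + b n \<in> S" "(\<lambda>n. a n + b n) \<longlonglongrightarrow> x + y"
    using assms by (auto intro: subspace_add tendsto_add)
  then show "x + y \<in> closure S"
    unfolding closure_sequential by (intro exI[of _ "\<lambda>n. a n + b n"]) auto
next
  fix c :: real and x assume "x \<in> closure S"
  then obtain a where "\<And>n. a n \<in> S" "a \<longlonglongrightarrow> x"
    unfolding closure_sequential by blast
  then have "\<And>n. c *\<^sub>R a n \<in> S" "(\<lambda>n. c *\<^sub>R a n) \<longlonglongrightarrow> c *\<^sub>R x"
    using assms by (auto intro: subspace_scale tendsto_scaleR)
  then show "c *\<^sub>R x \<in> closure S"
    unfolding closure_sequential by (intro exI[of _ "\<lambda>n. c *\<^sub>R a n"]) auto
qed

text \<open>This is the parallelogram law for \<open>x - a\<close> and \<open>x - b\<close>, whose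
  sum is twice \<open>x - midpoint a b\<close>.\<close>

lemma parallelogram_midpoint:
  fixes x a b :: "'a::real_inner"
  shows "(dist a b)\<^sup>2 = 2 * (dist x a)\<^sup>2 + 2 * (dist x b)\<^sup>2 - 4 * (dist x (midpoint a b))\<^sup>2"
  unfolding dist_norm power2_norm_eq_inner midpoint_def
  by (simp add: inner_diff_left inner_diff_right inner_add_left inner_add_right inner_commute
      field_simps)

text \<open>A minimizing sequence in \<open>S\<close> is Cauchy because convexity keeps midpoints in
  \<open>S\<close>; completeness then takes the place of compactness.\<close>

lemma closest_point_attained:
  fixes S :: "'a::{real_inner, complete_space} set"
  assumes "closed S" "convex S" "S \<noteq> {}"
  obtains p where "p \<in> S" "\<And>s. s \<in> S \<Longrightarrow> dist x p \<le> dist x s"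
proof -
  define d where "d = infdist x S"
  have d0: "0 \<le> d"
    by (simp add: d_def infdist_nonneg)
  have "\<exists>a\<in>S. (dist x a)\<^sup>2 < d\<^sup>2 + inverse (Suc n)" for n
  proof -
    have "d < sqrt (d\<^sup>2 + inverse (Suc n))"
      by (rule real_less_rsqrt) simp
    then obtain a where "a \<in> S" "dist x a < sqrt (d\<^sup>2 + inverse (Suc n))"
      using \<open>S \<noteq> {}\<close> unfolding d_def infdist_notempty[OF \<open>S \<noteq> {}\<close>]
      by (subst (asm) cINF_less_iff) auto
    then have "(dist x a)\<^sup>2 < (sqrt (d\<^sup>2 + inverse (Suc n)))\<^sup>2"
      by (intro power_strict_mono) auto
    also have "\<dots> = d\<^sup>2 + inverse (Suc n)"
      by (intro real_sqrt_pow2) (simp add: add_nonneg_nonneg)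
    finally show ?thesis
      using \<open>a \<in> S\<close> by blast
  qed
  then obtain a where aS: "\<And>n. a n \<in> S" and a: "\<And>n. (dist x (a n))\<^sup>2 < d\<^sup>2 + inverse (Suc n)"
    by metis
  have ab: "(dist (a m) (a n))\<^sup>2 < 2 * inverse (Suc m) + 2 * inverse (Suc n)" for m n
  proof -
    have "midpoint (a m) (a n) \<in> S"
      using \<open>convex S\<close> aS by (meson convex_contains_segment midpoint_in_closed_segment subsetD)
    \<comment> \<open>The midpoint is no closer to \<open>x\<close> than \<open>d\<close>, so the
      term with factor -4 cancels the two contributions of \<open>2 * d\<^sup>2\<close>, and only
      the errors remain.\<close>
    then have "d\<^sup>2 \<le> (dist x (midpoint (a m) (a n)))\<^sup>2"
      using d0 unfolding d_def by (intro power_mono infdist_le)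
    then show ?thesis
      using a[of m] a[of n] unfolding parallelogram_midpoint[of "a m" "a n" x] by linarith
  qed
  have "Cauchy a"
  proof (rule metric_CauchyI)
    fix e :: real assume "0 < e"
    \<comment> \<open>With this bound each of the two summands in \<open>ab\<close> is below half of
      \<open>e\<^sup>2\<close>.\<close>
    then obtain N where N: "inverse (real (Suc N)) < e\<^sup>2 / 4"
      by (metis reals_Archimedean zero_less_power zero_less_divide_iff zero_less_numeral)
    have "dist (a m) (a n) < e" if "N \<le> m" "N \<le> n" for m n
    proof -
      have "inverse (real (Suc k)) \<le> inverse (real (Suc N))" if "N \<le> k" for k
        using that by (intro le_imp_inverse_le) auto
      from this[OF \<open>N \<le> m\<close>] this[OF \<open>N \<le> n\<close>] have "(dist (a m) (a n))\<^sup>2 < e\<^sup>2"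
        using ab[of m n] N by linarith
      then show ?thesis
        using \<open>0 < e\<close> by (simp add: power2_less_imp_less)
    qed
    then show "\<exists>M. \<forall>m\<ge>M. \<forall>n\<ge>M. dist (a m) (a n) < e"
      by blast
  qed
  then obtain p where p: "a \<longlonglongrightarrow> p"
    unfolding convergent_eq_Cauchy[symmetric] by blast
  have "p \<in> S"
    using \<open>closed S\<close> aS p by (rule closed_sequentially)
  have "(dist x p)\<^sup>2 \<le> d\<^sup>2 + 0"
  proof (rule LIMSEQ_le)
    show "(\<lambda>n. (dist x (a n))\<^sup>2) \<longlonglongrightarrow> (dist x p)\<^sup>2"
      by (intro tendsto_intros p)
    show "(\<lambda>n. d\<^sup>2 + inverse (real (Suc n))) \<longlonglongrightarrow> d\<^sup>2 + 0"
      by (intro tendsto_intros LIMSEQ_inverse_real_of_nat)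
    show "\<exists>N. \<forall>n\<ge>N. (dist x (a n))\<^sup>2 \<le> d\<^sup>2 + inverse (real (Suc n))"
      using a less_imp_le by blast
  qed
  then have "dist x p \<le> d"
    unfolding add_0_right using d0 by (rule power2_le_imp_le)
  then have "dist x p \<le> dist x s" if "s \<in> S" for s
    using infdist_le[OF that, of x] unfolding d_def by linarith
  with \<open>p \<in> S\<close> show thesis
    by (rule that)
qed

text \<open>The closest point \<open>p\<close> works: its variational inequality, applied to both
  \<open>s\<close> and \<open>- s\<close>, becomes an equality on a subspace.\<close>

lemma orthogonal_projection_exists:
  fixes S :: "'a::{real_inner, complete_space} set"
  assumes "closed S" "subspace S"
  obtains p where "p \<in> S" "x - p \<in> S\<^sup>\<bottom>"
proof -
  obtain p where p: "p \<in> S" "\<And>s. s \<in> S \<Longrightarrow> dist x p \<le> dist x s"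
    using closest_point_attained[OF \<open>closed S\<close>, of x] assms(2) subspace_imp_convex subspace_0
    by blast
  \<comment> \<open>The competitor \<open>p + s\<close> stays in \<open>S\<close> and differs from
    \<open>p\<close> by exactly \<open>s\<close>.\<close>
  have "(x - p) \<bullet> s \<le> 0" if "s \<in> S" for s
    using any_closest_point_dot[of S p "p + s" x] assms p that
    by (simp add: subspace_imp_convex subspace_add)
  then have "s \<bullet> (x - p) = 0" if "s \<in> S" for s
    using that subspace_neg[OF assms(2) that]
    by (metis inner_commute inner_minus_right neg_le_0_iff_le order_antisym)
  with p(1) show thesis
    by (intro that) (auto simp: orthogonal_comp_def orthogonal_def)
qed

lemma orthogonal_comp_orthogonal_comp:
  fixes S :: "'a::{real_inner, complete_space} set"
  assumes "subspace S"
  shows "S\<^sup>\<bottom>\<^sup>\<bottom> = closure S"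
proof
  show "S\<^sup>\<bottom>\<^sup>\<bottom> \<subseteq> closure S"
  proof
    fix x assume x: "x \<in> S\<^sup>\<bottom>\<^sup>\<bottom>"
    \<comment> \<open>The aim is \<open>x = p\<close>: the residual \<open>x - p\<close> turns out
      orthogonal to both \<open>x\<close> and \<open>p\<close>, hence to itself.\<close>
    obtain p where p: "p \<in> closure S" "x - p \<in> (closure S)\<^sup>\<bottom>"
      using orthogonal_projection_exists[OF closed_closure subspace_closure[OF assms]] by blast
    have "x - p \<in> S\<^sup>\<bottom>"
      using p(2) orthogonal_comp_anti_mono[OF closure_subset] by blast
    then have "(x - p) \<bullet> x = 0"
      using x by (simp add: orthogonal_comp_def orthogonal_def)
    moreover have "(x - p) \<bullet> p = 0"
      using p by (simp add: orthogonal_comp_def orthogonal_def inner_commute)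
    ultimately have "(x - p) \<bullet> (x - p) = 0"
      by (simp only: inner_diff_right)
    then show "x \<in> closure S"
      using p(1) by simp
  qed
  \<comment> \<open>An intersection of closed hyperplanes is closed, so it contains the closure as
    soon as it contains \<open>S\<close>.\<close>
  have "S\<^sup>\<bottom>\<^sup>\<bottom> = (\<Inter>y\<in>S\<^sup>\<bottom>. {x. y \<bullet> x = 0})"
    by (auto simp: orthogonal_comp_def orthogonal_def)
  moreover have "closed \<dots>"
    by (intro closed_INT ballI closed_Collect_eq continuous_intros)
  ultimately show "closure S \<subseteq> S\<^sup>\<bottom>\<^sup>\<bottom>"
    using orthogonal_comp_subset by (metis closure_minimal)
qed

theorem riesz_representation:
  fixes f :: "'a::{real_inner, complete_space} \<Rightarrow> real"
  assumes "bounded_linear f"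
  obtains w where "\<And>x. f x = x \<bullet> w"
proof (cases "\<forall>x. f x = 0")
  case True
  then show thesis
    by (intro that[of 0]) simp
next
  case False
  interpret bounded_linear f by fact
  obtain u where u: "f u \<noteq> 0"
    using False by blast
  let ?K = "{x. f x = 0}"
  have "closed ?K"
    by (intro closed_Collect_eq continuous_on continuous_intros)
  moreover have "subspace ?K"
    by (rule subspaceI) (auto simp: add scaleR zero)
  ultimately obtain p where p: "p \<in> ?K" "u - p \<in> ?K\<^sup>\<bottom>"
    using orthogonal_projection_exists by blast
  define z where "z = u - p"
  have fz: "f z \<noteq> 0"
    using u p(1) by (simp add: z_def diff)
  then have zz: "z \<bullet> z \<noteq> 0"
    using zero by auto
  \<comment> \<open>The kernel has codimension one, so the representing vector is a multiple of
    \<open>z\<close>; the value at \<open>z\<close> forces the factor.\<close>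
  have "f x = x \<bullet> ((f z / (z \<bullet> z)) *\<^sub>R z)" for x
  proof -
    have "x - (f x / f z) *\<^sub>R z \<in> ?K"
      using fz by (simp add: diff scaleR)
    then have "(x - (f x / f z) *\<^sub>R z) \<bullet> z = 0"
      using p(2) unfolding z_def[symmetric] orthogonal_comp_def orthogonal_def by blast
    then show ?thesis
      using fz zz by (simp add: inner_diff_left field_simps)
  qed
  then show thesis
    by (rule that)
qed

section \<open>The Hilbert space adjoint\<close>

text \<open>Riesz representation gives a vector for each \<open>y\<close>. Choosing one for every
  \<open>y\<close> yields a map \<open>g\<close>, which uniqueness identifies with
  \<open>adjoint f\<close>.\<close>

lemma inner_adjoint_bounded_linear:
  fixes f :: "'a::{real_inner, complete_space} \<Rightarrow> 'b::real_inner"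
  assumes "bounded_linear f"
  shows "f x \<bullet> y = x \<bullet> adjoint f y"
proof -
  have "\<exists>w. \<forall>x. f x \<bullet> y = x \<bullet> w" for y
  proof -
    have "bounded_linear (\<lambda>x. f x \<bullet> y)"
      by (rule bounded_linear_compose[OF bounded_linear_inner_left assms])
    then show ?thesis
      by (rule riesz_representation) blast
  qed
  then obtain g where g: "\<forall>x y. f x \<bullet> y = x \<bullet> g y"
    by metis
  then show ?thesis
    using adjoint_unique[OF g] by simp
qed

lemma linear_if_inner_adjoint:
  fixes f :: "'a::real_inner \<Rightarrow> 'b::real_inner"
  assumes "\<And>x y. f x \<bullet> y = x \<bullet> g y"
  shows "linear g"
proof (rule linearI)
  show "g (x + y) = g x + g y" for x y
    by (subst vector_eq_ldot[symmetric]) (simp add: assms[symmetric] inner_add_right)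
  show "g (c *\<^sub>R x) = c *\<^sub>R g x" for c x
    by (subst vector_eq_ldot[symmetric]) (simp add: assms[symmetric])
qed

text \<open>Cauchy-Schwarz applied to \<open>f (g y) \<bullet> y\<close>, which is the square of the
  norm of \<open>g y\<close>; one factor is then cancelled.\<close>

lemma norm_le_if_inner_adjoint:
  fixes f :: "'a::real_inner \<Rightarrow> 'b::real_inner"
  assumes "\<And>x y. f x \<bullet> y = x \<bullet> g y" and "\<And>x. norm (f x) \<le> norm x"
  shows "norm (g y) \<le> norm y"
proof -
  have "norm (g y) * norm (g y) = f (g y) \<bullet> y"
    by (simp add: assms(1) flip: power2_eq_square power2_norm_eq_inner)
  also have "\<dots> \<le> norm (f (g y)) * norm y"
    by (rule norm_cauchy_schwarz)
  also have "\<dots> \<le> norm (g y) * norm y"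
    by (intro mult_right_mono assms) simp
  finally show ?thesis
    by (cases "g y = 0") auto
qed

lemma fixed_point_if_inner_eq:
  fixes x :: "'a::real_inner"
  assumes "norm (f x) \<le> norm x" "x \<bullet> f x = x \<bullet> x"
  shows "f x = x"
proof -
  have "(norm (f x))\<^sup>2 \<le> (norm x)\<^sup>2"
    using assms(1) by (intro power_mono) auto
  then have "(f x - x) \<bullet> (f x - x) \<le> 0"
    using assms(2)
    by (simp add: inner_diff_left inner_diff_right power2_norm_eq_inner inner_commute)
  then have "(f x - x) \<bullet> (f x - x) = 0"
    by (rule order_antisym) (rule inner_ge_zero)
  then show ?thesis
    by simp
qed

text \<open>If \<open>x \<bullet> g y = 0\<close> for all \<open>x\<close>, then the choice
  \<open>x = g y\<close> gives \<open>g y = 0\<close>.\<close>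

lemma orthogonal_comp_range:
  fixes f :: "'a::real_inner \<Rightarrow> 'b::real_inner"
  assumes "\<And>x y. f x \<bullet> y = x \<bullet> g y"
  shows "(range f)\<^sup>\<bottom> = {y. g y = 0}"
  using assms by (auto simp: orthogonal_comp_def orthogonal_def) (metis inner_eq_zero_iff)

text \<open>The right-hand side is the double orthogonal complement of the range.\<close>

lemma closure_range:
  fixes f :: "'a::real_inner \<Rightarrow> 'b::{real_inner, complete_space}"
  assumes "linear f" and "\<And>x y. f x \<bullet> y = x \<bullet> g y"
  shows "closure (range f) = {y. g y = 0}\<^sup>\<bottom>"
  using orthogonal_comp_orthogonal_comp[OF linear_subspace_image[OF assms(1) subspace_UNIV]]
    orthogonal_comp_range[of f g] assms(2) by simp

theorem lemma2p2:
  fixes R :: "'a::{real_inner, complete_space} \<Rightarrow> 'a"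
    and D :: "'a set"
  assumes "linear R"
    and "\<And>x y. norm (R x - R y) \<le> norm (x - y)"
    and "D = {x. x - R x = 0}"
  shows "D = Fix R
         \<and> (subspace D \<and> closed D)
         \<and> Fix (adjoint R) = D
         \<and> (closure (range (\<lambda>x. x - R x)) = closure (range (\<lambda>x. x - adjoint R x))
            \<and> closure (range (\<lambda>x. x - adjoint R x)) = D\<^sup>\<bottom>)"
proof -
  let ?T = "adjoint R"
  have R_le: "norm (R x) \<le> norm x" for x
    using assms(2)[of x 0] linear_0[OF assms(1)] by simp
  have bl: "bounded_linear R"
    using assms(1) R_le
    by (intro bounded_linear_intro[where K = 1]) (auto simp: linear_add linear_scale)
  have adj: "R x \<bullet> y = x \<bullet> ?T y" for x y
    using bl by (rule inner_adjoint_bounded_linear)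
  \<comment> \<open>Read this way, \<open>R\<close> is an adjoint of \<open>?T\<close>, so the
    general lemmas also apply with the two maps exchanged.\<close>
  have adj': "?T x \<bullet> y = x \<bullet> R y" for x y
    by (metis adj inner_commute)
  have T_le: "norm (?T x) \<le> norm x" for x
    using adj R_le by (rule norm_le_if_inner_adjoint)
  have DR: "D = Fix R"
    by (auto simp: assms(3) Fix_def)
  have lin: "linear (\<lambda>x. x - R x)" "linear (\<lambda>x. x - ?T x)"
    using assms(1) linear_if_inner_adjoint[of R ?T] adj
    by (auto intro: linear_compose_sub linear_ident)
  have "subspace D"
    unfolding assms(3) using lin(1) by (rule linear_subspace_kernel)
  moreover have "closed D"
    unfolding assms(3)
    by (intro closed_Collect_eq continuous_intros linear_continuous_on bl)
  moreover have FT: "Fix ?T = D"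
  proof -
    \<comment> \<open>A fixed point of either map satisfies the inner product condition for that
      map; \<open>adj[of x x]\<close> carries it over to the other.\<close>
    have "R x = x \<longleftrightarrow> ?T x = x" for x
      using fixed_point_if_inner_eq[of R x] fixed_point_if_inner_eq[of ?T x] R_le T_le adj[of x x]
      by (metis inner_commute)
    then show ?thesis
      by (simp add: DR Fix_def)
  qed
  moreover have "closure (range (\<lambda>x. x - R x)) = D\<^sup>\<bottom>"
  proof -
    \<comment> \<open>Here the kernel is that of \<open>Id - ?T\<close>, so (ii) is needed to reach
      \<open>D\<close>; for the range of \<open>Id - ?T\<close> below, the kernel is
      \<open>D\<close> by definition.\<close>
    have "closure (range (\<lambda>x. x - R x)) = {y. y - ?T y = 0}\<^sup>\<bottom>"
      using lin(1) by (rule closure_range) (simp add: adj inner_diff_left inner_diff_right)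
    also have "{y. y - ?T y = 0} = D"
      using FT by (auto simp: Fix_def)
    finally show ?thesis .
  qed
  moreover have "closure (range (\<lambda>x. x - ?T x)) = D\<^sup>\<bottom>"
    unfolding assms(3)
    using lin(2) by (rule closure_range) (simp add: adj' inner_diff_left inner_diff_right)
  ultimately show ?thesis
    using DR by simp
qed

end
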